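(* Let $f$ be a real-valued function and $g,h$ complex-valued functions on $\mathbb{R}^2$ satisfying the bilinear system $$D^2f\cdot f=2(f-|g|)^2,\qquad D^2g\cdot g=2gh,\qquad D^2g\cdot f=-(f-|g|)(g+h),$$ and suppose that $f$ is strictly positive. Then $\eta=g/f$ satisfies $$\Delta\eta-\frac{\bar\eta(\nabla\eta)^2}{|\eta|^2}\,\frac{1-|\eta|}{2-|\eta|}+\eta(1-|\eta|)(2-|\eta|)=0,$$ and the corresponding function $\psi$, with $\psi^2=\eta=g/f$, is a solution of the complex sine-Gordon II equation $$\Delta\psi+\frac{(\nabla\psi)^2\bar\psi}{2-|\psi|^2}+\frac12\psi(1-|\psi|^2)(2-|\psi|^2)=0 .$$
   Context: For complex-valued functions $f,g$ on $\mathbb{R}^2$, the Hirota bilinear operator is $D^2f\cdot g=(\Delta f)g-2\nabla f\cdot\nabla g+f\Delta g$, where $\nabla f\cdot\nabla g=f_xg_x+f_yg_y$ (no complex conjugation). Also $(\nabla\psi)^2=(\partial_x\psi)^2+(\partial_y\psi)^2$, and similarly for $\eta$. The equation for $\eta$ is the form taken by the complex sine-Gordon II equation under the substitution $\eta=\psi^2$. *)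

theory Defs
  imports "HOL-Analysis.Analysis"
begin

definition pderiv2 :: "2 \<Rightarrow> (real ^ 2 \<Rightarrow> 'a::real_normed_vector) \<Rightarrow> real ^ 2 \<Rightarrow> 'a"
  where "pderiv2 i F p = frechet_derivative F (at p) (axis i 1)"

text \<open>Intended for open \<open>U\<close>: twice continuously differentiable on \<open>U\<close>.\<close>

definition C2_on :: "(real ^ 2) set \<Rightarrow> (real ^ 2 \<Rightarrow> 'a::real_normed_vector) \<Rightarrow> bool"
  where "C2_on U F \<longleftrightarrow>
    (\<forall>p\<in>U. F differentiable (at p)) \<and>
    (\<forall>i. \<forall>p\<in>U. pderiv2 i F differentiable (at p)) \<and>
    (\<forall>i j. continuous_on U (pderiv2 i (pderiv2 j F)))"

definition laplacian :: "(real ^ 2 \<Rightarrow> complex) \<Rightarrow> real ^ 2 \<Rightarrow> complex"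
  where "laplacian F p = (\<Sum>i\<in>UNIV. pderiv2 i (pderiv2 i F) p)"

text \<open>The bilinear product of gradients, without complex conjugation; in particular
  \<open>grad_dot F F\<close> is \<open>(\<nabla>F)\<^sup>2\<close>.\<close>

definition grad_dot :: "(real ^ 2 \<Rightarrow> complex) \<Rightarrow> (real ^ 2 \<Rightarrow> complex) \<Rightarrow> real ^ 2 \<Rightarrow> complex"
  where "grad_dot F G p = (\<Sum>i\<in>UNIV. pderiv2 i F p * pderiv2 i G p)"

definition hirota :: "(real ^ 2 \<Rightarrow> complex) \<Rightarrow> (real ^ 2 \<Rightarrow> complex) \<Rightarrow> real ^ 2 \<Rightarrow> complex"
  where "hirota F G p =
    laplacian F p * G p - 2 * grad_dot F G p + F p * laplacian G p"

text \<open>Both equations below are singular and are required only at the points where no denominator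
  vanishes.  Since division by zero yields zero in HOL, the guards cannot be dropped: at a point
  with \<open>\<bar>\<eta>\<bar> = 2\<close> or \<open>\<eta> = 0\<close> the unguarded formula would force \<open>\<Delta>\<eta> = 0\<close> there, although the
  singular term may have a nonzero limit.  The second equation is regular at the zeros of \<open>\<psi>\<close>.\<close>

definition eta_solution_on :: "(real ^ 2) set \<Rightarrow> (real ^ 2 \<Rightarrow> complex) \<Rightarrow> bool"
  where "eta_solution_on U \<eta> \<longleftrightarrow> C2_on U \<eta> \<and>
    (\<forall>p\<in>U. \<eta> p \<noteq> 0 \<longrightarrow> cmod (\<eta> p) \<noteq> 2 \<longrightarrow>
      laplacian \<eta> p
      - cnj (\<eta> p) * grad_dot \<eta> \<eta> p / complex_of_real ((cmod (\<eta> p))\<^sup>2)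
          * complex_of_real ((1 - cmod (\<eta> p)) / (2 - cmod (\<eta> p)))
      + \<eta> p * complex_of_real ((1 - cmod (\<eta> p)) * (2 - cmod (\<eta> p))) = 0)"

definition csgII_solution_on :: "(real ^ 2) set \<Rightarrow> (real ^ 2 \<Rightarrow> complex) \<Rightarrow> bool"
  where "csgII_solution_on U \<psi> \<longleftrightarrow> C2_on U \<psi> \<and>
    (\<forall>p\<in>U. (cmod (\<psi> p))\<^sup>2 \<noteq> 2 \<longrightarrow>
      laplacian \<psi> p
      + grad_dot \<psi> \<psi> p * cnj (\<psi> p) / complex_of_real (2 - (cmod (\<psi> p))\<^sup>2)
      + 1 / 2 * \<psi> p
          * complex_of_real ((1 - (cmod (\<psi> p))\<^sup>2) * (2 - (cmod (\<psi> p))\<^sup>2)) = 0)"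

end

theory Submission imports Defs begin

text \<open>Substituting \<open>g = \<eta> f\<close> gives \<open>D\<^sup>2 g\<cdot>f = f\<^sup>2 \<Delta>\<eta> + \<eta> D\<^sup>2 f\<cdot>f\<close> and
  \<open>D\<^sup>2 g\<cdot>g = f\<^sup>2 D\<^sup>2 \<eta>\<cdot>\<eta> + \<eta>\<^sup>2 D\<^sup>2 f\<cdot>f\<close>.  Eliminating \<open>h\<close> and \<open>D\<^sup>2 f\<cdot>f\<close> and using
  \<open>1 + 2 (1 - r) + (1 - r)\<^sup>2 = (2 - r)\<^sup>2\<close> with \<open>r = \<bar>\<eta>\<bar>\<close> leaves an equation without denominators,
  valid everywhere.  For \<open>\<eta> = \<psi>\<^sup>2\<close> it is \<open>2 \<psi>\<^sup>3 (2 - \<bar>\<psi>\<bar>\<^sup>2)\<close> times the equation for \<open>\<psi>\<close>,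
  which settles the points with \<open>\<psi> \<noteq> 0\<close>.  A zero of \<open>\<psi>\<close> either is a limit of such points, so that continuity
  applies, or has a neighbourhood on which \<open>\<psi>\<close> vanishes.\<close>

subsection \<open>Partial derivatives\<close>

lemma pderiv2_eqI:
  assumes "(F has_derivative F') (at p)"
  shows "pderiv2 i F p = F' (axis i 1)"
  using frechet_derivative_at[OF assms] by (simp add: pderiv2_def)

lemma pderiv2_bounded_linear:
  assumes "bounded_linear T" "F differentiable (at p)"
  shows "pderiv2 i (\<lambda>x. T (F x)) p = T (pderiv2 i F p)"
  using pderiv2_eqI[OF bounded_linear.has_derivative[OF assms(1)]] assms(2)
  by (auto simp: frechet_derivative_works pderiv2_def)

lemma pderiv2_add:
  assumes "F differentiable (at p)" "G differentiable (at p)"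
  shows "pderiv2 i (\<lambda>x. F x + G x) p = pderiv2 i F p + pderiv2 i G p"
  using pderiv2_eqI[OF has_derivative_add] assms
  by (auto simp: frechet_derivative_works pderiv2_def)

lemma pderiv2_diff:
  assumes "F differentiable (at p)" "G differentiable (at p)"
  shows "pderiv2 i (\<lambda>x. F x - G x) p = pderiv2 i F p - pderiv2 i G p"
  using pderiv2_eqI[OF has_derivative_diff] assms
  by (auto simp: frechet_derivative_works pderiv2_def)

lemma pderiv2_mult:
  fixes F G :: "real ^ 2 \<Rightarrow> 'a::real_normed_algebra"
  assumes "F differentiable (at p)" "G differentiable (at p)"
  shows "pderiv2 i (\<lambda>x. F x * G x) p = F p * pderiv2 i G p + pderiv2 i F p * G p"
  using pderiv2_eqI[OF has_derivative_mult] assms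
  by (auto simp: frechet_derivative_works pderiv2_def)

lemma pderiv2_divide:
  fixes F G :: "real ^ 2 \<Rightarrow> 'a::real_normed_field"
  assumes "F differentiable (at p)" "G differentiable (at p)" "G p \<noteq> 0"
  shows "pderiv2 i (\<lambda>x. F x / G x) p = (pderiv2 i F p * G p - F p * pderiv2 i G p) / (G p * G p)"
  using pderiv2_eqI[OF has_derivative_divide'] assms
  by (auto simp: frechet_derivative_works pderiv2_def)

lemma differentiable_cong_open:
  assumes "open U" "p \<in> U" "\<And>x. x \<in> U \<Longrightarrow> F x = G x" "F differentiable (at p)"
  shows "G differentiable (at p)"
  using assms has_derivative_transform_within_open[of F _ p UNIV U G]
  unfolding differentiable_def by auto

text \<open>Near \<open>p\<close> the functions agree, so they have the same set of derivatives
  there. The choice operator in \<open>frechet_derivative\<close> therefore picks the same map for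
  both, even where neither is differentiable.\<close>

lemma pderiv2_cong_open:
  assumes "open U" "p \<in> U" "\<And>x. x \<in> U \<Longrightarrow> F x = G x"
  shows "pderiv2 i F p = pderiv2 i G p"
proof -
  have "(F has_derivative D) (at p) \<longleftrightarrow> (G has_derivative D) (at p)" for D
    using has_derivative_transform_within_open[of F D p UNIV U G]
      has_derivative_transform_within_open[of G D p UNIV U F] assms by auto
  then show ?thesis
    by (simp add: pderiv2_def frechet_derivative_def)
qed

subsection \<open>Functions of class \<open>C\<^sup>1\<close> and \<open>C\<^sup>2\<close>\<close>

text \<open>Closure properties are proved for this class with one use of each derivative rule, then
  lifted to \<open>C2_on\<close> through formulas for the first partials.\<close>

definition C1_on :: "(real ^ 2) set \<Rightarrow> (real ^ 2 \<Rightarrow> 'a::real_normed_vector) \<Rightarrow> bool"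
  where "C1_on U F \<longleftrightarrow>
    (\<forall>p\<in>U. F differentiable (at p)) \<and> (\<forall>i. continuous_on U (pderiv2 i F))"

lemma differentiable_imp_continuous_on_open:
  "(\<And>p. p \<in> U \<Longrightarrow> F differentiable (at p)) \<Longrightarrow> continuous_on U F"
  by (meson continuous_at_imp_continuous_on differentiable_imp_continuous_within)

lemma C1_on_imp_continuous_on: "C1_on U F \<Longrightarrow> continuous_on U F"
  by (auto simp: C1_on_def intro: differentiable_imp_continuous_on_open)

lemma C1_onD: "C1_on U F \<Longrightarrow> p \<in> U \<Longrightarrow> F differentiable (at p)"
  by (simp add: C1_on_def)

lemma C2_on_iff_C1_on_pderiv2:
  "C2_on U F \<longleftrightarrow> (\<forall>p\<in>U. F differentiable (at p)) \<and> (\<forall>i. C1_on U (pderiv2 i F))"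
  by (auto simp: C2_on_def C1_on_def)

lemma C2_onD:
  assumes "C2_on U F"
  shows "p \<in> U \<Longrightarrow> F differentiable (at p)"
    and "p \<in> U \<Longrightarrow> pderiv2 i F differentiable (at p)"
    and "C1_on U (pderiv2 i F)"
    and "C1_on U F"
    and "continuous_on U (pderiv2 i (pderiv2 j F))"
  using assms by (auto simp: C2_on_def C1_on_def intro: differentiable_imp_continuous_on_open)

lemma C2_on_subset: "C2_on U F \<Longrightarrow> V \<subseteq> U \<Longrightarrow> C2_on V F"
  unfolding C2_on_def by (meson continuous_on_subset subsetD)

lemma C1_on_cong:
  assumes "open U" "\<And>x. x \<in> U \<Longrightarrow> F x = G x" "C1_on U F"
  shows "C1_on U G"
proof -
  have "continuous_on U (pderiv2 i G)" for i
    using assms pderiv2_cong_open[of U _ F G] by (auto simp: C1_on_def cong: continuous_on_cong)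
  then show ?thesis
    using assms differentiable_cong_open[of U _ F G] by (auto simp: C1_on_def)
qed

text \<open>Under an explicit formula for the first derivatives, \<open>C\<^sup>2\<close> reduces to \<open>C\<^sup>1\<close> of that formula.\<close>

lemma C2_onI:
  assumes "open U" "\<And>p. p \<in> U \<Longrightarrow> F differentiable (at p)"
    and "\<And>i p. p \<in> U \<Longrightarrow> pderiv2 i F p = F' i p" and "\<And>i. C1_on U (F' i)"
  shows "C2_on U F"
  using assms C1_on_cong[of U "F' _" "pderiv2 _ F"] by (auto simp: C2_on_iff_C1_on_pderiv2)

lemma C1_on_bounded_linear:
  assumes "bounded_linear T" "C1_on U F"
  shows "C1_on U (\<lambda>x. T (F x))"
  using assms
  by (auto simp: C1_on_def pderiv2_bounded_linear bounded_linear.continuous_on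
      bounded_linear_imp_differentiable cong: continuous_on_cong
      intro: differentiable_chain_at[unfolded o_def])

lemma C1_on_diff:
  assumes "C1_on U F" "C1_on U G"
  shows "C1_on U (\<lambda>x. F x - G x)"
  using assms
  by (auto simp: C1_on_def pderiv2_diff cong: continuous_on_cong intro!: continuous_intros)

lemma C1_on_mult:
  fixes F G :: "real ^ 2 \<Rightarrow> 'a::real_normed_algebra"
  assumes "C1_on U F" "C1_on U G"
  shows "C1_on U (\<lambda>x. F x * G x)"
  using assms C1_on_imp_continuous_on[OF assms(1)] C1_on_imp_continuous_on[OF assms(2)]
  by (auto simp: C1_on_def pderiv2_mult cong: continuous_on_cong intro!: continuous_intros)

lemma C1_on_divide:
  fixes F G :: "real ^ 2 \<Rightarrow> 'a::real_normed_field"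
  assumes "C1_on U F" "C1_on U G" "\<And>x. x \<in> U \<Longrightarrow> G x \<noteq> 0"
  shows "C1_on U (\<lambda>x. F x / G x)"
  using assms C1_on_imp_continuous_on[OF assms(1)] C1_on_imp_continuous_on[OF assms(2)]
  by (auto simp: C1_on_def pderiv2_divide cong: continuous_on_cong intro!: continuous_intros)

lemma C2_on_bounded_linear:
  assumes "open U" "bounded_linear T" "C2_on U F"
  shows "C2_on U (\<lambda>x. T (F x))"
proof (rule C2_onI[OF assms(1)])
  fix p i assume "p \<in> U"
  then show "pderiv2 i (\<lambda>x. T (F x)) p = T (pderiv2 i F p)"
    by (intro pderiv2_bounded_linear assms C2_onD(1)[OF assms(3)])
next
  show "C1_on U (\<lambda>p. T (pderiv2 i F p))" for i
    using C1_on_bounded_linear[OF assms(2) C2_onD(3)[OF assms(3)]] .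
  show "(\<lambda>x. T (F x)) differentiable (at p)" if "p \<in> U" for p
    using C1_onD[OF C1_on_bounded_linear[OF assms(2) C2_onD(4)[OF assms(3)]] that] .
qed

lemma C2_on_divide:
  fixes F G :: "real ^ 2 \<Rightarrow> 'a::real_normed_field"
  assumes "open U" "C2_on U F" "C2_on U G" "\<And>x. x \<in> U \<Longrightarrow> G x \<noteq> 0"
  shows "C2_on U (\<lambda>x. F x / G x)"
proof (rule C2_onI[OF assms(1)])
  fix p i assume "p \<in> U"
  then show "pderiv2 i (\<lambda>x. F x / G x) p =
      (pderiv2 i F p * G p - F p * pderiv2 i G p) / (G p * G p)"
    by (intro pderiv2_divide assms C2_onD(1)[OF assms(2)] C2_onD(1)[OF assms(3)])
next
  fix i show "C1_on U (\<lambda>p. (pderiv2 i F p * G p - F p * pderiv2 i G p) / (G p * G p))"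
    using assms by (intro C1_on_divide C1_on_diff C1_on_mult) (auto intro: C2_onD)
qed (use assms C2_onD(1) in \<open>auto intro!: differentiable_divide\<close>)

text \<open>Near \<open>p\<close> the quotient \<open>\<psi> / \<psi> p\<close> has positive real part, so it is the principal branch of the
  square root of \<open>\<psi>\<^sup>2 / (\<psi> p)\<^sup>2\<close>.\<close>

lemma differentiable_continuous_sqrt:
  fixes \<psi> :: "'a::real_normed_vector \<Rightarrow> complex"
  assumes "open U" "p \<in> U" "continuous_on U \<psi>" "\<psi> p \<noteq> 0"
    and "(\<lambda>x. (\<psi> x)\<^sup>2) differentiable (at p)"
  shows "\<psi> differentiable (at p)"
proof -
  define V where "V = U \<inter> (\<lambda>q. \<psi> q / \<psi> p) -` {z. Re z > 0}"
  have "continuous_on U (\<lambda>q. \<psi> q / \<psi> p)"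
    using assms by (intro continuous_intros) auto
  from continuous_open_preimage[OF this assms(1) open_halfspace_Re_gt] assms
  have V: "open V" "p \<in> V"
    by (auto simp: V_def)
  have eq: "\<psi> p * csqrt ((\<psi> q)\<^sup>2 / (\<psi> p)\<^sup>2) = \<psi> q" if "q \<in> V" for q
    using that assms(4) csqrt_square[of "\<psi> q / \<psi> p"] by (simp add: V_def power_divide)
  obtain D where "((\<lambda>x. (\<psi> x)\<^sup>2) has_derivative D) (at p)"
    using assms(5) by (auto simp: differentiable_def)
  then have inner: "((\<lambda>x. (\<psi> x)\<^sup>2 / (\<psi> p)\<^sup>2) has_derivative (\<lambda>v. D v / (\<psi> p)\<^sup>2)) (at p)"
    by (rule bounded_linear.has_derivative[OF bounded_linear_divide])
  \<comment> \<open>At \<open>p\<close> the argument of \<open>csqrt\<close> equals 1, which is off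
    the branch cut.\<close>
  have "(csqrt has_field_derivative inverse (2 * csqrt 1)) (at 1)"
    by (rule has_field_derivative_csqrt) (simp add: complex_nonpos_Reals_iff)
  then have "(csqrt has_derivative (*) (inverse (2 * csqrt 1))) (at ((\<psi> p)\<^sup>2 / (\<psi> p)\<^sup>2))"
    using assms(4) by (simp add: has_field_derivative_def)
  from has_derivative_compose[OF inner this]
  have "(\<lambda>q. csqrt ((\<psi> q)\<^sup>2 / (\<psi> p)\<^sup>2)) differentiable (at p)"
    by (auto simp: differentiable_def)
  then have "(\<lambda>q. \<psi> p * csqrt ((\<psi> q)\<^sup>2 / (\<psi> p)\<^sup>2)) differentiable (at p)"
    by (intro differentiable_mult differentiable_const)
  then show ?thesis
    by (rule differentiable_cong_open[OF V, rotated]) (rule eq)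
qed

text \<open>Bootstrapping: the partials of \<open>\<psi>\<close> are those of its square divided by
  2 \<open>\<psi>\<close>. Continuity of \<open>\<psi>\<close> makes this quotient continuous, so
  \<open>\<psi>\<close> is of class C1; then the quotient is of class C1 as well.\<close>

lemma C2_on_continuous_sqrt:
  fixes \<psi> :: "real ^ 2 \<Rightarrow> complex"
  assumes U: "open U" and cont: "continuous_on U \<psi>" and nz: "\<And>p. p \<in> U \<Longrightarrow> \<psi> p \<noteq> 0"
    and C2: "C2_on U (\<lambda>x. (\<psi> x)\<^sup>2)"
  shows "C2_on U \<psi>"
proof -
  have diff: "\<psi> differentiable (at p)" if "p \<in> U" for p
    using differentiable_continuous_sqrt[OF U that cont nz[OF that]] C2_onD(1)[OF C2 that] .
  define D where "D i p = pderiv2 i (\<lambda>x. (\<psi> x)\<^sup>2) p / (\<psi> p + \<psi> p)" for i p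
  have D: "pderiv2 i \<psi> p = D i p" if "p \<in> U" for i p
    using pderiv2_mult[OF diff[OF that] diff[OF that], of i] nz[OF that]
    by (simp add: D_def power2_eq_square field_simps)
  have nz2: "\<psi> p + \<psi> p \<noteq> 0" if "p \<in> U" for p
    using nz[OF that] by (simp flip: mult_2)
  have "continuous_on U (D i)" for i
    unfolding D_def using C1_on_imp_continuous_on[OF C2_onD(3)[OF C2]] cont nz2
    by (intro continuous_intros) auto
  then have "continuous_on U (pderiv2 i \<psi>)" for i
    using D by (simp cong: continuous_on_cong)
  with diff have "C1_on U \<psi>"
    by (simp add: C1_on_def)
  then have "C1_on U (\<lambda>p. \<psi> p + \<psi> p)"
    using C1_on_bounded_linear[OF bounded_linear_mult_right[of "2::complex"], of U \<psi>]
    by (simp only: mult_2)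
  then have "C1_on U (D i)" for i
    unfolding D_def by (rule C1_on_divide[OF C2_onD(3)[OF C2]]) (rule nz2)
  then show ?thesis
    by (intro C2_onI[OF U diff D])
qed

subsection \<open>Product rules for the Hirota operator\<close>

lemma grad_dot_mult_left:
  assumes "F differentiable (at p)" "G differentiable (at p)"
  shows "grad_dot (\<lambda>x. F x * G x) H p = F p * grad_dot G H p + G p * grad_dot F H p"
  by (simp add: grad_dot_def pderiv2_mult assms sum_distrib_left sum.distrib[symmetric]
      algebra_simps)

lemma grad_dot_commute: "grad_dot F G p = grad_dot G F p"
  by (simp add: grad_dot_def mult.commute)

lemma laplacian_mult:
  assumes "open U" "p \<in> U" "C2_on U F" "C2_on U G"
  shows "laplacian (\<lambda>x. F x * G x) p =
    laplacian F p * G p + 2 * grad_dot F G p + F p * laplacian G p"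
proof -
  note d = C2_onD(1,2)[OF assms(3)] C2_onD(1,2)[OF assms(4)]
  \<comment> \<open>The product rule for first partials holds on all of \<open>U\<close>, so it may
    be differentiated again at \<open>p\<close>.\<close>
  have "pderiv2 i (pderiv2 i (\<lambda>x. F x * G x)) p =
      pderiv2 i (\<lambda>x. F x * pderiv2 i G x + pderiv2 i F x * G x) p" for i
    using assms(1,2) by (rule pderiv2_cong_open) (simp add: pderiv2_mult d)
  also have "\<dots> i = pderiv2 i (pderiv2 i F) p * G p + 2 * (pderiv2 i F p * pderiv2 i G p)
      + F p * pderiv2 i (pderiv2 i G) p" for i
    using assms(2) by (simp add: pderiv2_add pderiv2_mult d algebra_simps)
  finally show ?thesis
    by (simp add: laplacian_def grad_dot_def sum.distrib sum_distrib_left sum_distrib_right)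
qed

text \<open>The Laplacian of the product contributes 2 \<open>F p * grad_dot \<eta> F p\<close>,
  which the gradient term of the Hirota operator cancels.\<close>

lemma hirota_mult_left:
  assumes "open U" "p \<in> U" "C2_on U \<eta>" "C2_on U F"
  shows "hirota (\<lambda>x. \<eta> x * F x) F p = (F p)\<^sup>2 * laplacian \<eta> p + \<eta> p * hirota F F p"
  unfolding hirota_def laplacian_mult[OF assms]
    grad_dot_mult_left[OF C2_onD(1)[OF assms(3,2)] C2_onD(1)[OF assms(4,2)]]
  by (simp add: power2_eq_square algebra_simps)

text \<open>Again the mixed terms in \<open>grad_dot \<eta> F p\<close> cancel: each of the two
  Laplacians contributes 2 \<open>\<eta> p * F p\<close> times it, and the gradient term removes
  4.\<close>

lemma hirota_mult_mult:
  assumes "open U" "p \<in> U" "C2_on U \<eta>" "C2_on U F"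
  shows "hirota (\<lambda>x. \<eta> x * F x) (\<lambda>x. \<eta> x * F x) p =
    (F p)\<^sup>2 * hirota \<eta> \<eta> p + (\<eta> p)\<^sup>2 * hirota F F p"
proof -
  note grad = grad_dot_mult_left[OF C2_onD(1)[OF assms(3,2)] C2_onD(1)[OF assms(4,2)]]
  have "grad_dot (\<lambda>x. \<eta> x * F x) (\<lambda>x. \<eta> x * F x) p =
      (\<eta> p)\<^sup>2 * grad_dot F F p + 2 * \<eta> p * F p * grad_dot \<eta> F p + (F p)\<^sup>2 * grad_dot \<eta> \<eta> p"
    unfolding grad grad_dot_commute[of F "\<lambda>x. \<eta> x * F x"]
      grad_dot_commute[of \<eta> "\<lambda>x. \<eta> x * F x"]
    by (simp add: grad_dot_commute[of F \<eta>] power2_eq_square algebra_simps)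
  then show ?thesis
    unfolding hirota_def laplacian_mult[OF assms]
    by (simp add: power2_eq_square algebra_simps)
qed

subsection \<open>The equations for \<open>\<eta>\<close> and \<open>\<psi>\<close>\<close>

text \<open>Elimination at a single point. Here \<open>r\<close> stands for the modulus of
  \<open>\<eta> p\<close>, so that \<open>F p * (1 - r)\<close> represents f - |g|.\<close>

lemma hirota_system_imp_eta_equation:
  fixes \<eta> F h :: "real ^ 2 \<Rightarrow> complex" and r :: complex
  assumes U: "open U" "p \<in> U" "C2_on U \<eta>" "C2_on U F" and "F p \<noteq> 0"
    and FF: "hirota F F p = 2 * (F p * (1 - r))\<^sup>2"
    and gg: "hirota (\<lambda>x. \<eta> x * F x) (\<lambda>x. \<eta> x * F x) p = 2 * (\<eta> p * F p) * h p"
    and gF: "hirota (\<lambda>x. \<eta> x * F x) F p = - (F p * (1 - r)) * (\<eta> p * F p + h p)"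
  shows "\<eta> p * laplacian \<eta> p * (2 - r) - (1 - r) * grad_dot \<eta> \<eta> p
    + (\<eta> p)\<^sup>2 * (1 - r) * (2 - r)\<^sup>2 = 0"
proof -
  define e f k L G where "e = \<eta> p" "f = F p" "k = h p" "L = laplacian \<eta> p" "G = grad_dot \<eta> \<eta> p"
  note defs = this
  have 1: "f\<^sup>2 * L + e * (2 * (f * (1 - r))\<^sup>2) = - (f * (1 - r)) * (e * f + k)"
    using trans[OF hirota_mult_left[OF U, symmetric] gF] unfolding FF defs .
  have 2: "f\<^sup>2 * (2 * (e * L) - 2 * G) + e\<^sup>2 * (2 * (f * (1 - r))\<^sup>2) = 2 * (e * f) * k"
  proof -
    have *: "hirota \<eta> \<eta> p = 2 * (e * L) - 2 * G"
      by (simp add: defs hirota_def algebra_simps)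
    show ?thesis
      using trans[OF hirota_mult_mult[OF U, symmetric] gg] unfolding FF * defs .
  qed
  have "f ^ 3 * (e * L * (2 - r) - (1 - r) * G + e\<^sup>2 * (1 - r) * (2 - r)\<^sup>2) = 0"
  proof -
    \<comment> \<open>The multipliers \<open>2 * e * f\<close> and \<open>f * (1 - r)\<close> are
      chosen so that the terms in \<open>k\<close> cancel.\<close>
    have "2 * (f ^ 3 * (e * L * (2 - r) - (1 - r) * G + e\<^sup>2 * (1 - r) * (2 - r)\<^sup>2))
      = 2 * e * f * ((f\<^sup>2 * L + e * (2 * (f * (1 - r))\<^sup>2)) + f * (1 - r) * (e * f + k))
        + f * (1 - r) * ((f\<^sup>2 * (2 * (e * L) - 2 * G) + e\<^sup>2 * (2 * (f * (1 - r))\<^sup>2))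
          - 2 * (e * f) * k)"
      by (simp add: power2_eq_square power3_eq_cube algebra_simps)
    also have "\<dots> = 0"
      unfolding 1 2 by simp
    finally show ?thesis
      by simp
  qed
  then show ?thesis
    using assms(5) unfolding defs mult_eq_0_iff by simp
qed

text \<open>With s, G, c as in the proof, the gradient terms combine to \<open>2 * s\<^sup>2 * G *
  (2 - r) - 4 * s\<^sup>2 * G * (1 - r) = 2 * s\<^sup>2 * G * r\<close>, and
  \<open>r = s * c\<close> supplies the third factor s.\<close>

lemma csgII_equation_at_nonzero:
  fixes \<psi> :: "real ^ 2 \<Rightarrow> complex"
  assumes U: "open U" "p \<in> U" "C2_on U \<psi>" and nz: "\<psi> p \<noteq> 0" and n2: "(cmod (\<psi> p))\<^sup>2 \<noteq> 2"
    and r: "r = complex_of_real ((cmod (\<psi> p))\<^sup>2)"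
    and eq: "(\<psi> p)\<^sup>2 * laplacian (\<lambda>x. (\<psi> x)\<^sup>2) p * (2 - r)
      - (1 - r) * grad_dot (\<lambda>x. (\<psi> x)\<^sup>2) (\<lambda>x. (\<psi> x)\<^sup>2) p + ((\<psi> p)\<^sup>2)\<^sup>2 * (1 - r) * (2 - r)\<^sup>2 = 0"
  shows "laplacian \<psi> p + grad_dot \<psi> \<psi> p * cnj (\<psi> p) / (2 - r)
    + 1 / 2 * \<psi> p * ((1 - r) * (2 - r)) = 0"
proof -
  define s c L G where "s = \<psi> p" "c = cnj (\<psi> p)" "L = laplacian \<psi> p" "G = grad_dot \<psi> \<psi> p"
  note defs = this
  have d: "\<psi> differentiable (at p)"
    using C2_onD(1)[OF U(3,2)] .
  have rc: "r = s * c"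
    unfolding r defs complex_norm_square ..
  have lap: "laplacian (\<lambda>x. (\<psi> x)\<^sup>2) p = 2 * s * L + 2 * G"
    using laplacian_mult[OF U(1,2,3,3)] by (simp add: power2_eq_square defs algebra_simps)
  have grad: "grad_dot (\<lambda>x. (\<psi> x)\<^sup>2) (\<lambda>x. (\<psi> x)\<^sup>2) p = 4 * s\<^sup>2 * G"
    by (simp add: power2_eq_square defs grad_dot_mult_left[OF d d]
        grad_dot_commute[of \<psi> "\<lambda>x. \<psi> x * \<psi> x"])
  have n2': "2 - r \<noteq> 0"
    using n2 of_real_eq_iff[of 2 "(cmod (\<psi> p))\<^sup>2", where 'a=complex] unfolding r by auto
  have "2 * s ^ 3 * (L * (2 - r) + G * c + 1 / 2 * s * (1 - r) * (2 - r)\<^sup>2) = 0"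
  proof -
    \<comment> \<open>The correction term with \<open>s * c - r\<close> makes this an identity in
      independent variables.\<close>
    have "2 * s ^ 3 * (L * (2 - r) + G * c + 1 / 2 * s * (1 - r) * (2 - r)\<^sup>2)
      = s\<^sup>2 * (2 * s * L + 2 * G) * (2 - r) - (1 - r) * (4 * s\<^sup>2 * G)
        + (s\<^sup>2)\<^sup>2 * (1 - r) * (2 - r)\<^sup>2 + 2 * s\<^sup>2 * G * (s * c - r)"
      by (simp add: power2_eq_square power3_eq_cube field_simps)
    moreover have "s\<^sup>2 * (2 * s * L + 2 * G) * (2 - r) - (1 - r) * (4 * s\<^sup>2 * G)
        + (s\<^sup>2)\<^sup>2 * (1 - r) * (2 - r)\<^sup>2 = 0"
      using eq unfolding lap grad defs(1)[symmetric] .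
    moreover have "s * c - r = 0"
      by (simp add: rc)
    ultimately show ?thesis
      by (simp only: mult_zero_right add_0_right)
  qed
  then have "L * (2 - r) + G * c + 1 / 2 * s * (1 - r) * (2 - r)\<^sup>2 = 0"
    using nz unfolding defs mult_eq_0_iff by simp
  moreover have "L + G * c / (2 - r) + 1 / 2 * s * ((1 - r) * (2 - r))
      = (L * (2 - r) + G * c + 1 / 2 * s * (1 - r) * (2 - r)\<^sup>2) / (2 - r)"
    using n2' by (simp add: field_simps power2_eq_square)
  ultimately have "L + G * c / (2 - r) + 1 / 2 * s * ((1 - r) * (2 - r)) = 0"
    by (simp only: div_0)
  then show ?thesis
    unfolding defs .
qed

text \<open>The left-hand side \<open>E\<close> is continuous where its denominator is nonzero. If
  \<open>E p\<close> were nonzero, \<open>E\<close> would be nonzero on a neighbourhood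
  \<open>W\<close> of \<open>p\<close>; by \<open>nonzero\<close>, \<open>\<psi>\<close> would
  vanish on \<open>W\<close>, hence so would its derivatives, forcing
  \<open>E p = 0\<close>.\<close>

lemma csgII_solution_onI:
  fixes \<psi> :: "real ^ 2 \<Rightarrow> complex"
  assumes U: "open U" and C2: "C2_on U \<psi>"
    and nonzero: "\<And>p. p \<in> U \<Longrightarrow> \<psi> p \<noteq> 0 \<Longrightarrow> (cmod (\<psi> p))\<^sup>2 \<noteq> 2 \<Longrightarrow>
      laplacian \<psi> p
      + grad_dot \<psi> \<psi> p * cnj (\<psi> p) / complex_of_real (2 - (cmod (\<psi> p))\<^sup>2)
      + 1 / 2 * \<psi> p
          * complex_of_real ((1 - (cmod (\<psi> p))\<^sup>2) * (2 - (cmod (\<psi> p))\<^sup>2)) = 0"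
  shows "csgII_solution_on U \<psi>"
proof -
  define E where "E p = laplacian \<psi> p
      + grad_dot \<psi> \<psi> p * cnj (\<psi> p) / complex_of_real (2 - (cmod (\<psi> p))\<^sup>2)
      + 1 / 2 * \<psi> p
          * complex_of_real ((1 - (cmod (\<psi> p))\<^sup>2) * (2 - (cmod (\<psi> p))\<^sup>2))" for p
  note cont = C1_on_imp_continuous_on[OF C2_onD(4)[OF C2]]
  have "E p = 0" if p: "p \<in> U" "(cmod (\<psi> p))\<^sup>2 \<noteq> 2" for p
  proof (rule ccontr)
    assume neq: "E p \<noteq> 0"
    define V where "V = U \<inter> (\<lambda>x. (cmod (\<psi> x))\<^sup>2) -` (- {2})"
    have V: "open V" "p \<in> V" "V \<subseteq> U"
      using p U cont unfolding V_def
      by (auto intro!: continuous_open_preimage continuous_intros)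
    have ne: "complex_of_real (2 - (cmod (\<psi> x))\<^sup>2) \<noteq> 0" if "x \<in> V" for x
      using that unfolding V_def of_real_eq_0_iff by auto
    have "continuous_on V E"
      unfolding E_def laplacian_def grad_dot_def
      by (intro continuous_intros ballI ne continuous_on_subset[OF cont V(3)]
          continuous_on_subset[OF C2_onD(5)[OF C2] V(3)]
          continuous_on_subset[OF C1_on_imp_continuous_on[OF C2_onD(3)[OF C2]] V(3)])
    define W where "W = V \<inter> E -` (- {0})"
    have W: "open W" "p \<in> W" "W \<subseteq> V"
      using V neq \<open>continuous_on V E\<close>
      by (auto simp: W_def intro!: continuous_open_preimage)
    have zero: "\<psi> x = 0" if "x \<in> W" for x
      using nonzero[of x] that V(3) by (auto simp: W_def V_def E_def)
    have const: "pderiv2 i (\<lambda>x. 0 :: complex) = (\<lambda>x. 0)" for i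
      by (rule ext, rule pderiv2_eqI) (rule has_derivative_const)
    have "pderiv2 i \<psi> x = 0" if "x \<in> W" for i x
      using pderiv2_cong_open[OF W(1) that zero, where i = i] const by simp
    then have "pderiv2 i (pderiv2 i \<psi>) p = 0" for i
      using pderiv2_cong_open[OF W(1,2), where F = "pderiv2 i \<psi>" and G = "\<lambda>x. 0" and i = i] const by simp
    then have "E p = 0"
      using zero[OF W(2)] by (simp add: E_def laplacian_def)
    with neq show False ..
  qed
  then show ?thesis
    using C2 by (auto simp: csgII_solution_on_def E_def)
qed

text \<open>A complex function need not have a global continuous square root. Hence
  \<open>\<psi>\<close> is any pointwise root, and regularity is asked only on an open set
  \<open>U\<close>, where a continuous root without zeros is automatically C2.\<close>

theorem mainTheorem5:
  fixes f :: "real ^ 2 \<Rightarrow> real" and g h :: "real ^ 2 \<Rightarrow> complex"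
  defines "F \<equiv> \<lambda>p. complex_of_real (f p)"
  assumes "C2_on UNIV f" and "C2_on UNIV g"
    and "\<And>p. hirota F F p = 2 * (complex_of_real (f p - cmod (g p)))\<^sup>2"
    and "\<And>p. hirota g g p = 2 * g p * h p"
    and "\<And>p. hirota g F p = - complex_of_real (f p - cmod (g p)) * (g p + h p)"
    and "\<And>p. f p > 0"
  shows "eta_solution_on UNIV (\<lambda>p. g p / F p) \<and>
    (\<forall>\<psi>. (\<forall>p. (\<psi> p)\<^sup>2 = g p / F p) \<longrightarrow>
      (\<forall>U. open U \<and> (C2_on U \<psi> \<or> (continuous_on U \<psi> \<and> (\<forall>p\<in>U. \<psi> p \<noteq> 0))) \<longrightarrow>
        csgII_solution_on U \<psi>))"
proof -
  define \<eta> where "\<eta> = (\<lambda>p. g p / F p)"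
  have F0: "F p \<noteq> 0" for p
    using assms(7)[of p] by (simp add: F_def)
  have C2F: "C2_on UNIV F"
    unfolding F_def using C2_on_bounded_linear[OF open_UNIV bounded_linear_of_real assms(2)] .
  have C2\<eta>: "C2_on UNIV \<eta>"
    unfolding \<eta>_def using C2_on_divide[OF open_UNIV assms(3) C2F] F0 by blast
  have g: "g = (\<lambda>p. \<eta> p * F p)"
    using F0 by (simp add: \<eta>_def)
  have \<eta>F: "\<eta> p * F p = g p" for p
    using F0 by (simp add: \<eta>_def)
  \<comment> \<open>Positivity of \<open>f\<close> gives |g| = |\<open>\<eta>\<close>| f.\<close>
  have fg: "complex_of_real (f p - cmod (g p)) = F p * (1 - complex_of_real (cmod (\<eta> p)))" for p
    using assms(7)[of p] by (simp add: g F_def norm_mult algebra_simps)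
  have eq: "\<eta> p * laplacian \<eta> p * (2 - r) - (1 - r) * grad_dot \<eta> \<eta> p
      + (\<eta> p)\<^sup>2 * (1 - r) * (2 - r)\<^sup>2 = 0" if "r = complex_of_real (cmod (\<eta> p))" for p r
    unfolding that
    by (rule hirota_system_imp_eta_equation[where h = h, OF open_UNIV UNIV_I C2\<eta> C2F F0])
      (use assms(4-6)[of p] fg[of p] in \<open>simp_all add: \<eta>F del: of_real_diff\<close>)
  have "eta_solution_on UNIV \<eta>"
    unfolding eta_solution_on_def
  proof (intro conjI C2\<eta> ballI impI)
    fix p assume nz: "\<eta> p \<noteq> 0" and n2: "cmod (\<eta> p) \<noteq> 2"
    define r where "r = complex_of_real (cmod (\<eta> p))"
    have r: "\<eta> p * cnj (\<eta> p) = r\<^sup>2"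
      unfolding r_def by (metis complex_norm_square of_real_power)
    have r2: "2 - r \<noteq> 0"
      using n2 of_real_eq_iff[of 2 "cmod (\<eta> p)", where 'a=complex] by (auto simp: r_def)
    have r0: "r \<noteq> 0"
      using nz by (simp add: r_def)
    \<comment> \<open>This turns the singular coefficient into 1 / \<open>\<eta> p\<close>, so the
      equation becomes \<open>eq\<close> divided by \<open>\<eta> p * (2 - r)\<close>.\<close>
    have c: "cnj (\<eta> p) = r\<^sup>2 / \<eta> p"
      using r nz by (simp add: field_simps)
    have "laplacian \<eta> p - cnj (\<eta> p) * grad_dot \<eta> \<eta> p / r\<^sup>2 * ((1 - r) / (2 - r))
        + \<eta> p * ((1 - r) * (2 - r)) =
      (\<eta> p * laplacian \<eta> p * (2 - r) - (1 - r) * grad_dot \<eta> \<eta> p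
        + (\<eta> p)\<^sup>2 * (1 - r) * (2 - r)\<^sup>2) / (\<eta> p * (2 - r))"
    proof -
      have *: "r\<^sup>2 / \<eta> p * grad_dot \<eta> \<eta> p / r\<^sup>2 = grad_dot \<eta> \<eta> p / \<eta> p"
        using r0 by simp
      show ?thesis
        unfolding c * using r2 nz by (simp add: field_simps power2_eq_square)
    qed
    also have "\<dots> = 0"
      using eq[OF r_def] by simp
    finally show "laplacian \<eta> p
      - cnj (\<eta> p) * grad_dot \<eta> \<eta> p / complex_of_real ((cmod (\<eta> p))\<^sup>2)
          * complex_of_real ((1 - cmod (\<eta> p)) / (2 - cmod (\<eta> p)))
      + \<eta> p * complex_of_real ((1 - cmod (\<eta> p)) * (2 - cmod (\<eta> p))) = 0"
      by (simp add: r_def)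
  qed
  moreover have "csgII_solution_on U \<psi>"
    if \<psi>: "\<And>p. (\<psi> p)\<^sup>2 = \<eta> p" and U: "open U"
      and reg: "C2_on U \<psi> \<or> (continuous_on U \<psi> \<and> (\<forall>p\<in>U. \<psi> p \<noteq> 0))" for \<psi> U
  proof (rule csgII_solution_onI[OF U])
    have \<eta>: "\<eta> = (\<lambda>p. (\<psi> p)\<^sup>2)"
      using \<psi> by simp
    show C2: "C2_on U \<psi>"
      using reg C2_on_continuous_sqrt[OF U] C2_on_subset[OF C2\<eta>, of U] by (auto simp: \<eta>)
    fix p assume p: "p \<in> U" "\<psi> p \<noteq> 0" "(cmod (\<psi> p))\<^sup>2 \<noteq> 2"
    \<comment> \<open>The squared modulus of \<open>\<psi>\<close> is the modulus of
      \<open>\<eta>\<close>, so both equations share the same \<open>r\<close>.\<close>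
    have "complex_of_real ((cmod (\<psi> p))\<^sup>2) = complex_of_real (cmod (\<eta> p))"
      by (simp add: \<eta> norm_power)
    from csgII_equation_at_nonzero[OF U p(1) C2 p(2,3) refl] eq[OF this]
    show "laplacian \<psi> p
      + grad_dot \<psi> \<psi> p * cnj (\<psi> p) / complex_of_real (2 - (cmod (\<psi> p))\<^sup>2)
      + 1 / 2 * \<psi> p
          * complex_of_real ((1 - (cmod (\<psi> p))\<^sup>2) * (2 - (cmod (\<psi> p))\<^sup>2)) = 0"
      by (simp add: \<eta>)
  qed
  ultimately show ?thesis
    unfolding \<eta>_def by blast
qed

end
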